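(* Let $G$ be an AG-group of order $n$. Then the set $\{L_a, R_a : a\in G\}$ forms a non-abelian group of order $2n$, which is called the multiplication group of the AG-group $G$ and is denoted by $M(G)$, i.e. $M(G)=\{L_a, R_a : a\in G\}$.
   Context: An AG-group is a set $G$ with a binary operation (written as juxtaposition) such that: (i) $(xy)z=(zy)x$ for all $x,y,z\in G$ (left invertive law); (ii) there exists a left identity $e\in G$, i.e. $ex=x$ for all $x\in G$; (iii) for every $x\in G$ there exists $x^{-1}\in G$ such that $x^{-1}x=xx^{-1}=e$. The order of $G$ is its cardinality. For $a\in G$, the left and right translations are the maps $L_a,R_a:G\to G$, $L_a(x)=ax$ and $R_a(x)=xa$. The product of two mappings is composition: $(fg)(x)=f(g(x))$.
   Formalization: "Non-abelian" and "of order 2n" are claimed only for non-associative G: an associative AG-group is an abelian group, where L_a = R_a, so the set has n elements and is abelian. That the set forms a group is claimed for every finite AG-group. *)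

theory Defs
  imports "HOL-Algebra.Coset"
begin

(* The left identity e is the record component one; inverses are two-sided with respect to it.
   Only the left identity law is assumed, and no associativity. *)
locale AG_group =
  fixes G (structure)
  assumes m_closed: "\<lbrakk>x \<in> carrier G; y \<in> carrier G\<rbrakk> \<Longrightarrow> x \<otimes> y \<in> carrier G"
    and left_invertive: "\<lbrakk>x \<in> carrier G; y \<in> carrier G; z \<in> carrier G\<rbrakk>
          \<Longrightarrow> (x \<otimes> y) \<otimes> z = (z \<otimes> y) \<otimes> x"
    and one_closed: "\<one> \<in> carrier G"
    and l_one: "x \<in> carrier G \<Longrightarrow> \<one> \<otimes> x = x"
    and inverse_ex: "x \<in> carrier G \<Longrightarrow> \<exists>y\<in>carrier G. y \<otimes> x = \<one> \<and> x \<otimes> y = \<one>"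

(* Maps from the carrier to itself are represented extensionally (undefined outside the carrier),
   so that HOL equality of translations is equality of maps on the carrier. *)
definition left_translation :: "('a, 'b) monoid_scheme \<Rightarrow> 'a \<Rightarrow> 'a \<Rightarrow> 'a"
  where "left_translation G a = (\<lambda>x\<in>carrier G. a \<otimes>\<^bsub>G\<^esub> x)"

definition right_translation :: "('a, 'b) monoid_scheme \<Rightarrow> 'a \<Rightarrow> 'a \<Rightarrow> 'a"
  where "right_translation G a = (\<lambda>x\<in>carrier G. x \<otimes>\<^bsub>G\<^esub> a)"

definition multiplication_group :: "('a, 'b) monoid_scheme \<Rightarrow> ('a \<Rightarrow> 'a) monoid"
  where "multiplication_group G =
    \<lparr>carrier = left_translation G ` carrier G \<union> right_translation G ` carrier G,
     mult = compose (carrier G),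
     one = (\<lambda>x\<in>carrier G. x)\<rparr>"

end

theory Submission
  imports Defs
begin

text \<open>
  Behind an AG-group stands an abelian group with an involution. The map
  \<open>\<sigma> x = x \<otimes> \<one>\<close> is an involutive automorphism, \<open>x * y = \<sigma> x \<otimes> y\<close> is an abelian
  group operation, and \<open>x \<otimes> y = \<sigma> x * y\<close>. So \<open>L\<^sub>a\<close> is the translation by \<open>\<sigma> a\<close> of
  this abelian group, and \<open>R\<^sub>a\<close> is \<open>\<sigma>\<close> followed by the translation by \<open>a\<close>. Together these
  maps form a homomorphic image of the semidirect product of the abelian group with the group
  of order 2 that acts by \<open>\<sigma>\<close>. If \<open>\<sigma>\<close> is not the identity, the image is faithful:
  it has \<open>2n\<close> elements and is not abelian. If \<open>\<sigma>\<close> is the identity, the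
  AG-group is itself an abelian group, in particular associative.

  The proof works with \<open>\<otimes>\<close> directly. Translations of the same kind compose
  to a left translation and those of different kinds to a right translation
  (\<open>left_left\<close>, \<open>left_right\<close>, \<open>right_left\<close>, \<open>right_right\<close>), which
  gives closure and inverses. An index can be read off from the value of a translation at \<open>\<one>\<close>,
  so each kind contributes \<open>n\<close> maps. A map of both kinds would force
  \<open>\<sigma> = id\<close>, and so would commutativity, since \<open>L\<^sub>a R\<^sub>1 = R\<^sub>c\<close> for
  \<open>c = \<sigma> a\<close> whereas \<open>R\<^sub>1 L\<^sub>a = R\<^sub>a\<close>; both are excluded by
  \<open>assoc_if_right_one\<close>.
\<close>

context AG_group
begin

abbreviation L where "L \<equiv> left_translation G"
abbreviation R where "R \<equiv> right_translation G"

lemma medial: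
  assumes "a \<in> carrier G" "b \<in> carrier G" "c \<in> carrier G" "d \<in> carrier G"
  shows "(a \<otimes> b) \<otimes> (c \<otimes> d) = (a \<otimes> c) \<otimes> (b \<otimes> d)"
proof -
  have "(a \<otimes> b) \<otimes> (c \<otimes> d) = ((c \<otimes> d) \<otimes> b) \<otimes> a"
    using assms by (intro left_invertive m_closed)
  also have "\<dots> = ((b \<otimes> d) \<otimes> c) \<otimes> a"
    using assms by (simp add: left_invertive[of c d b])
  also have "\<dots> = (a \<otimes> c) \<otimes> (b \<otimes> d)"
    using assms by (intro left_invertive m_closed)
  finally show ?thesis .
qed

lemma left_commute:
  assumes "a \<in> carrier G" "b \<in> carrier G" "c \<in> carrier G"
  shows "a \<otimes> (b \<otimes> c) = b \<otimes> (a \<otimes> c)"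
  using medial[of \<one> a b c] assms by (simp add: one_closed l_one)

lemma right_one_right_one: "a \<in> carrier G \<Longrightarrow> (a \<otimes> \<one>) \<otimes> \<one> = a"
  using left_invertive[of a \<one> \<one>] by (simp add: one_closed l_one)

text \<open>
  If the left identity is two-sided, the left invertive law with middle argument \<open>\<one>\<close> is
  commutativity, and in a commutative structure the left invertive law is associativity.
\<close>
lemma assoc_if_right_one:
  assumes right_one: "\<And>a. a \<in> carrier G \<Longrightarrow> a \<otimes> \<one> = a"
    and xyz: "x \<in> carrier G" "y \<in> carrier G" "z \<in> carrier G"
  shows "(x \<otimes> y) \<otimes> z = x \<otimes> (y \<otimes> z)"
proof -
  have comm: "a \<otimes> b = b \<otimes> a" if "a \<in> carrier G" "b \<in> carrier G" for a b
    using left_invertive[OF that(1) one_closed that(2)] that by (simp add: right_one)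
  have "(x \<otimes> y) \<otimes> z = (z \<otimes> y) \<otimes> x"
    using xyz by (rule left_invertive)
  also have "\<dots> = x \<otimes> (y \<otimes> z)"
    using xyz by (metis comm m_closed)
  finally show ?thesis .
qed

text \<open>
  The index on the right is \<open>a * b\<close>, and its image under \<open>\<sigma>\<close> is \<open>\<sigma> a * \<sigma> b\<close>:
  two translations of the abelian group compose to a translation.
\<close>
lemma left_left:
  assumes "a \<in> carrier G" "b \<in> carrier G"
  shows "compose (carrier G) (L a) (L b) = L ((a \<otimes> \<one>) \<otimes> b)"
proof -
  have "a \<otimes> (b \<otimes> x) = ((a \<otimes> \<one>) \<otimes> b) \<otimes> x" if x: "x \<in> carrier G" for x
  proof -
    have "((a \<otimes> \<one>) \<otimes> b) \<otimes> x = (x \<otimes> b) \<otimes> (a \<otimes> \<one>)"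
      using assms x by (intro left_invertive m_closed one_closed)
    also have "\<dots> = a \<otimes> ((x \<otimes> b) \<otimes> \<one>)"
      using assms x by (intro left_commute m_closed one_closed)
    also have "\<dots> = a \<otimes> (b \<otimes> x)"
      using assms x by (simp add: left_invertive[of x b \<one>] one_closed l_one)
    finally show ?thesis ..
  qed
  then show ?thesis
    using assms by (auto simp: compose_def left_translation_def m_closed intro!: restrict_ext)
qed

lemma left_right:
  assumes "a \<in> carrier G" "b \<in> carrier G"
  shows "compose (carrier G) (L a) (R b) = R (a \<otimes> b)"
  using assms
  by (auto simp: compose_def left_translation_def right_translation_def m_closed left_commute[of a]
      intro!: restrict_ext)

lemma right_left:
  assumes "a \<in> carrier G" "b \<in> carrier G"
  shows "compose (carrier G) (R a) (L b) = R ((b \<otimes> \<one>) \<otimes> a)"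
proof -
  have "(b \<otimes> x) \<otimes> a = x \<otimes> ((b \<otimes> \<one>) \<otimes> a)" if x: "x \<in> carrier G" for x
  proof -
    have "x \<otimes> ((b \<otimes> \<one>) \<otimes> a) = (b \<otimes> \<one>) \<otimes> (x \<otimes> a)"
      using assms x by (intro left_commute m_closed one_closed)
    also have "\<dots> = (b \<otimes> x) \<otimes> a"
      using assms x by (simp add: medial[of b \<one> x a] one_closed l_one)
    finally show ?thesis ..
  qed
  then show ?thesis
    using assms
    by (auto simp: compose_def left_translation_def right_translation_def m_closed
        intro!: restrict_ext)
qed

text \<open>This is the left invertive law itself; the two occurrences of \<open>\<sigma>\<close> cancel.\<close>
lemma right_right:
  assumes "a \<in> carrier G" "b \<in> carrier G"
  shows "compose (carrier G) (R a) (R b) = L (a \<otimes> b)"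
  using assms
  by (auto simp: compose_def left_translation_def right_translation_def m_closed
      left_invertive[of _ b a] intro!: restrict_ext)

lemma left_one: "L \<one> = (\<lambda>x\<in>carrier G. x)"
  by (auto simp: left_translation_def l_one intro!: restrict_ext)

lemma inj_on_left: "inj_on L (carrier G)"
proof (rule inj_onI)
  fix a b assume ab: "a \<in> carrier G" "b \<in> carrier G" and "L a = L b"
  then have "L a \<one> = L b \<one>" by simp
  then have "a \<otimes> \<one> = b \<otimes> \<one>" by (simp add: left_translation_def one_closed)
  then show "a = b" using ab right_one_right_one by metis
qed

lemma inj_on_right: "inj_on R (carrier G)"
proof (rule inj_onI)
  fix a b assume ab: "a \<in> carrier G" "b \<in> carrier G" and "R a = R b"
  then have "R a \<one> = R b \<one>" by simp
  then show "a = b" using ab by (simp add: right_translation_def one_closed l_one)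
qed

text \<open>
  The index of the inverse is \<open>c \<otimes> \<one>\<close> rather than the inverse \<open>c\<close> of \<open>a\<close>,
  because \<open>left_left\<close> multiplies the outer index by \<open>\<one>\<close> once more.
\<close>
lemma left_inverse_ex:
  assumes "a \<in> carrier G"
  shows "\<exists>b\<in>carrier G. compose (carrier G) (L b) (L a) = (\<lambda>x\<in>carrier G. x)"
proof -
  obtain c where c: "c \<in> carrier G" "c \<otimes> a = \<one>"
    using inverse_ex[OF assms] by blast
  then have "compose (carrier G) (L (c \<otimes> \<one>)) (L a) = L \<one>"
    using assms by (simp add: left_left m_closed one_closed right_one_right_one)
  then show ?thesis
    using c by (auto simp: left_one m_closed one_closed)
qed

lemma right_inverse_ex:
  assumes "a \<in> carrier G"
  shows "\<exists>b\<in>carrier G. compose (carrier G) (R b) (R a) = (\<lambda>x\<in>carrier G. x)"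
  using inverse_ex[OF assms] assms right_right left_one by metis

lemma left_cancel:
  assumes "a \<in> carrier G" "x \<in> carrier G" "y \<in> carrier G" "a \<otimes> x = a \<otimes> y"
  shows "x = y"
proof -
  obtain b where b: "compose (carrier G) (L b) (L a) = (\<lambda>x\<in>carrier G. x)"
    using left_inverse_ex[OF assms(1)] by blast
  have "L b (a \<otimes> z) = z" if "z \<in> carrier G" for z
    using fun_cong[OF b, of z] that by (simp add: compose_eq left_translation_def[of G a])
  then show ?thesis using assms by metis
qed

lemma group_multiplication_group: "group (multiplication_group G)"
proof (rule groupI, unfold multiplication_group_def, simp_all only: monoid.simps partial_object.simps)
  let ?M = "L ` carrier G \<union> R ` carrier G"
  have maps: "f \<in> carrier G \<rightarrow>\<^sub>E carrier G" if "f \<in> ?M" for f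
    using that by (auto simp: left_translation_def right_translation_def m_closed)
  show "(\<lambda>x\<in>carrier G. x) \<in> ?M"
    using left_one one_closed by (metis UnI1 imageI)
  show "compose (carrier G) f g \<in> ?M" if "f \<in> ?M" "g \<in> ?M" for f g
    using that by (auto simp: left_left left_right right_left right_right m_closed one_closed)
  show "compose (carrier G) (compose (carrier G) f g) h
      = compose (carrier G) f (compose (carrier G) g h)"
    if "f \<in> ?M" "g \<in> ?M" "h \<in> ?M" for f g h
    using maps[OF that(3)] compose_assoc[of h "carrier G" "carrier G" f g]
    by (simp add: PiE_def)
  show "compose (carrier G) (\<lambda>x\<in>carrier G. x) f = f" if "f \<in> ?M" for f
    using maps[OF that] by (intro Id_compose) (auto simp: PiE_def)
  show "\<exists>g\<in>?M. compose (carrier G) g f = (\<lambda>x\<in>carrier G. x)" if "f \<in> ?M" for f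
    using that left_inverse_ex right_inverse_ex by blast
qed

text \<open>
  Evaluating \<open>L\<^sub>a = R\<^sub>b\<close> at \<open>\<one>\<close> gives \<open>b = a \<otimes> \<one>\<close>, so
  \<open>a \<otimes> x = x \<otimes> (a \<otimes> \<one>) = a \<otimes> (x \<otimes> \<one>)\<close>: one coincidence
  makes \<open>\<one>\<close> two-sided.
\<close>
lemma right_one_if_left_eq_right:
  assumes a: "a \<in> carrier G" and b: "b \<in> carrier G" and eq: "L a = R b"
    and x: "x \<in> carrier G"
  shows "x \<otimes> \<one> = x"
proof -
  have val: "a \<otimes> y = y \<otimes> b" if "y \<in> carrier G" for y
    using fun_cong[OF eq, of y] that by (simp add: left_translation_def right_translation_def)
  have "b = a \<otimes> \<one>"
    using val[OF one_closed] b by (simp add: l_one)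
  then have "a \<otimes> x = a \<otimes> (x \<otimes> \<one>)"
    using val[OF x] left_commute[OF a x one_closed] by simp
  then show ?thesis
    using left_cancel[OF a x m_closed[OF x one_closed]] by simp
qed

lemma right_one_if_comm:
  assumes "comm_group (multiplication_group G)" and a: "a \<in> carrier G"
  shows "a \<otimes> \<one> = a"
proof -
  interpret M: comm_group "multiplication_group G" by fact
  have "compose (carrier G) (L a) (R \<one>) = compose (carrier G) (R \<one>) (L a)"
    using M.m_comm[of "L a" "R \<one>"] a one_closed by (simp add: multiplication_group_def)
  then have "R (a \<otimes> \<one>) = R a"
    using a by (simp add: left_right right_left one_closed right_one_right_one)
  then show ?thesis
    using inj_onD[OF inj_on_right] a m_closed one_closed by blast
qed

lemma order_multiplication_group:
  assumes "finite (carrier G)" and "L ` carrier G \<inter> R ` carrier G = {}"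
  shows "order (multiplication_group G) = 2 * order G"
  using assms
  by (simp add: order_def multiplication_group_def card_Un_disjoint
      card_image inj_on_left inj_on_right)

end

(* An associative AG-group is an abelian group; there left and right translations coincide, so
   being non-abelian of order 2n requires that G is not associative. *)
theorem theorem2:
  fixes G :: "('a, 'b) monoid_scheme" (structure) and n :: nat
  assumes "AG_group G"
    and "finite (carrier G)"
    and "order G = n"
  shows "group (multiplication_group G) \<and>
    (\<not> (\<forall>x\<in>carrier G. \<forall>y\<in>carrier G. \<forall>z\<in>carrier G. (x \<otimes> y) \<otimes> z = x \<otimes> (y \<otimes> z)) \<longrightarrow>
      \<not> comm_group (multiplication_group G) \<and>
      order (multiplication_group G) = 2 * n)"
proof (intro conjI impI)
  interpret AG_group G by fact
  show "group (multiplication_group G)"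
    by (rule group_multiplication_group)
  assume "\<not> (\<forall>x\<in>carrier G. \<forall>y\<in>carrier G. \<forall>z\<in>carrier G. (x \<otimes> y) \<otimes> z = x \<otimes> (y \<otimes> z))"
  then obtain c where c: "c \<in> carrier G" "c \<otimes> \<one> \<noteq> c"
    using assoc_if_right_one by blast
  show "\<not> comm_group (multiplication_group G)"
    using right_one_if_comm c by blast
  have "L ` carrier G \<inter> R ` carrier G = {}"
    using right_one_if_left_eq_right c by blast
  then show "order (multiplication_group G) = 2 * n"
    using order_multiplication_group assms by simp
qed

end
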